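(* Let $g:\mathrm{St}(r,n,\mathbb{C})\to\mathbb{R}^{+}$, $g(U)=f(U,U,\dots,U)$, be the symmetric variant of a smooth symmetric function $f$, suppose that $g$ is convex, and let $U_k$ ($k\ge1$) be the iterates produced by Algorithm PDOI from a starting point $U_0$. If there exists $\delta>0$ such that $\sigma_{\min}(\nabla g(U_{k-1}))>\delta$ for all $k\ge 1$, then every accumulation point of the iterates $U_k$ is a stationary point of $g$.
   Context: For $1\le r\le n$, $\mathrm{St}(r,n,\mathbb{C})=\{X\in\mathbb{C}^{n\times r}:X^{H}X=I_r\}$. $\mathbb{C}^{n\times r}$ is a real Euclidean space with inner product $\langle X,Y\rangle_{\Re}=\Re\,\mathrm{tr}(X^{H}Y)$. $\nabla g$ is the Euclidean gradient with respect to this inner product; the Riemannian gradient is $\mathrm{grad}\,g(U)=\nabla g(U)-U\,\mathrm{sym}(U^{H}\nabla g(U))$, $\mathrm{sym}(X)=\tfrac12(X+X^{H})$; $U$ is a stationary point if $\mathrm{grad}\,g(U)=0$. Problem. $d>1$, $f$ is a smooth function from the $d$-fold product $\Omega_s=\mathrm{St}(r,n,\mathbb{C})\times\cdots\times\mathrm{St}(r,n,\mathbb{C})$ to $\mathbb{R}^{+}=[0,\infty)$ which is symmetric, i.e. invariant under permutations of its $d$ arguments. $g(U)=f(U,\dots,U)$; $g$ also denotes its natural (smooth) extension to $\mathbb{C}^{n\times r}$, and convexity and Euclidean gradients refer to this extension. Polar decomposition. Every $X\in\mathbb{C}^{n\times r}$ can be written $X=UP$ with $U\in\mathrm{St}(r,n,\mathbb{C})$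 (the orthogonal polar factor) and $P$ Hermitian positive semidefinite; $U$ is unique if $X$ has full column rank. $\sigma_{\min}$ is the smallest singular value. Algorithm PDOI. Start from $U_0\in\mathrm{St}(r,n,\mathbb{C})$ with $g(U_0)>0$; for $k=1,2,\dots$ let $U_k$ be the orthogonal polar factor of $\nabla g(U_{k-1})$. *)

theory Defs
  imports "HOL-Analysis.Analysis"
begin

section \<open>Complex matrices\<close>

text \<open>An n-by-r complex matrix is an element of \<open>complex^'r^'n\<close> (rows indexed by \<open>'n\<close>).\<close>

definition conj_transpose :: "complex^'r^'n \<Rightarrow> complex^'n^'r" where
  "conj_transpose X = (\<chi> i j. cnj (X $ j $ i))"

text \<open>The library inner product of matrices is the real Euclidean inner product
  \<open>Re (tr (X\<^sup>H Y))\<close>, so the library's gradients with respect to it can be used as they are.\<close>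

lemma inner_matrix_eq_Re_trace:
  fixes X Y :: "complex^'r^'n"
  shows "X \<bullet> Y = Re (trace (conj_transpose X ** Y))"
proof -
  have "X \<bullet> Y = (\<Sum>i\<in>UNIV. \<Sum>j\<in>UNIV. Re (cnj (X $ i $ j) * Y $ i $ j))"
    by (simp add: inner_vec_def inner_complex_def)
  also have "\<dots> = (\<Sum>j\<in>UNIV. \<Sum>i\<in>UNIV. Re (cnj (X $ i $ j) * Y $ i $ j))"
    by (rule sum.swap)
  also have "\<dots> = Re (trace (conj_transpose X ** Y))"
    by (simp add: trace_def conj_transpose_def matrix_matrix_mult_def)
  finally show ?thesis .
qed

definition Stiefel :: "(complex^'r^'n) set" where
  "Stiefel = {X. conj_transpose X ** X = mat 1}"

definition hermitian_part :: "complex^'r^'r \<Rightarrow> complex^'r^'r" where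
  "hermitian_part X = (1 / 2) *\<^sub>R (X + conj_transpose X)"

text \<open>The real inner product below is \<open>Re (v\<^sup>H P v)\<close>; for Hermitian \<open>P\<close>, \<open>v\<^sup>H P v\<close> is real.\<close>

definition hermitian_psd :: "complex^'r^'r \<Rightarrow> bool" where
  "hermitian_psd P \<longleftrightarrow> conj_transpose P = P \<and> (\<forall>v. 0 \<le> v \<bullet> (P *v v))"

text \<open>A relation rather than a function, because the factor is unique only at full column rank.\<close>

definition orthogonal_polar_factor :: "complex^'r^'n \<Rightarrow> complex^'r^'n \<Rightarrow> bool" where
  "orthogonal_polar_factor X U \<longleftrightarrow> U \<in> Stiefel \<and> (\<exists>P. hermitian_psd P \<and> X = U ** P)"

text \<open>Singular values are the square roots of the eigenvalues of the r-by-r matrix \<open>X\<^sup>H X\<close>.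
  This is the usual convention (\<open>min n r\<close> singular values, counted with multiplicity) when
  \<open>r \<le> n\<close>, and it is only used in that case.\<close>

definition singular_values :: "complex^'r^'n \<Rightarrow> real set" where
  "singular_values X = {s. 0 \<le> s \<and>
     (\<exists>v. v \<noteq> 0 \<and> (conj_transpose X ** X) *v v = complex_of_real (s\<^sup>2) *s v)}"

definition sigma_min :: "complex^'r^'n \<Rightarrow> real" where
  "sigma_min X = Min (singular_values X)"


section \<open>Smoothness\<close>

text \<open>\<open>C_k_on k S f\<close> is meant for open \<open>S\<close> and a finite-dimensional domain: all iterated
  directional derivatives up to order \<open>k\<close> exist, as Frechet derivatives applied to fixed
  vectors, and are continuous on \<open>S\<close>.\<close>

primrec C_k_on :: "nat \<Rightarrow> 'a::euclidean_space set \<Rightarrow> ('a \<Rightarrow> real) \<Rightarrow> bool" where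
  "C_k_on 0 S f \<longleftrightarrow> continuous_on S f"
| "C_k_on (Suc k) S f \<longleftrightarrow> (\<forall>x\<in>S. f differentiable (at x)) \<and>
     (\<forall>v. C_k_on k S (\<lambda>x. frechet_derivative f (at x) v))"

text \<open>A function on a subset \<open>S\<close> of a Euclidean space (here an embedded submanifold) is smooth
  if near every point of \<open>S\<close> it is the restriction of a smooth function on an open set. Only the
  values of \<open>f\<close> on \<open>S\<close> matter.\<close>

definition smooth_on :: "'a::euclidean_space set \<Rightarrow> ('a \<Rightarrow> real) \<Rightarrow> bool" where
  "smooth_on S f \<longleftrightarrow> (\<forall>x\<in>S. \<exists>W h. open W \<and> x \<in> W \<and> (\<forall>k. C_k_on k W h) \<and>
     (\<forall>y\<in>S \<inter> W. h y = f y))"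


section \<open>Symmetric functions on products of Stiefel manifolds\<close>

text \<open>The \<open>d\<close> arguments are indexed by a finite type \<open>'d\<close> with \<open>CARD('d) = d\<close>.\<close>

definition Omega_s :: "((complex^'r^'n)^'d) set" where
  "Omega_s = {X. \<forall>i. X $ i \<in> Stiefel}"

definition symmetric_on_Omega_s :: "((complex^'r^'n)^'d \<Rightarrow> real) \<Rightarrow> bool" where
  "symmetric_on_Omega_s f \<longleftrightarrow>
     (\<forall>p. bij p \<longrightarrow> (\<forall>X\<in>Omega_s. f (\<chi> i. X $ p i) = f X))"


section \<open>Gradients and stationary points\<close>

definition eucl_grad :: "('a::real_inner \<Rightarrow> real) \<Rightarrow> 'a \<Rightarrow> 'a" where
  "eucl_grad g X = (THE D. GDERIV g X :> D)"

definition riem_grad :: "(complex^'r^'n \<Rightarrow> real) \<Rightarrow> complex^'r^'n \<Rightarrow> complex^'r^'n" where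
  "riem_grad g U =
     eucl_grad g U - U ** hermitian_part (conj_transpose U ** eucl_grad g U)"

definition stationary_point :: "(complex^'r^'n \<Rightarrow> real) \<Rightarrow> complex^'r^'n \<Rightarrow> bool" where
  "stationary_point g U \<longleftrightarrow> U \<in> Stiefel \<and> riem_grad g U = 0"


section \<open>The algorithm\<close>

definition PDOI_iterates :: "(complex^'r^'n \<Rightarrow> real) \<Rightarrow> (nat \<Rightarrow> complex^'r^'n) \<Rightarrow> bool" where
  "PDOI_iterates g U \<longleftrightarrow> U 0 \<in> Stiefel \<and> g (U 0) > 0 \<and>
     (\<forall>k\<ge>1. orthogonal_polar_factor (eucl_grad g (U (k - 1))) (U k))"

definition accumulation_point :: "(nat \<Rightarrow> 'a::topological_space) \<Rightarrow> 'a \<Rightarrow> bool" where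
  "accumulation_point U V \<longleftrightarrow> (\<exists>s :: nat \<Rightarrow> nat. strict_mono s \<and> (U \<circ> s) \<longlonglongrightarrow> V)"

end

theory Submission
  imports Defs
begin

text \<open>Write \<open>G\<^sub>k\<close> for the gradient of \<open>g\<close> at \<open>U\<^sub>k\<close>; it factors as
  \<open>G\<^sub>k = U\<^sub>k\<^sub>+\<^sub>1 P\<^sub>k\<close> with \<open>P\<^sub>k\<close> Hermitian positive semidefinite. Consecutive iterates
  become arbitrarily close, so the gradient at an accumulation point \<open>V\<close> is \<open>V\<close> times a Hermitian
  matrix, and this makes \<open>V\<close> stationary.

  With \<open>D = U\<^sub>k\<^sub>+\<^sub>1 - U\<^sub>k\<close>, convexity bounds the increase of \<open>g\<close> from below by the inner product of
  \<open>D\<close> and \<open>G\<^sub>k\<close>. Because both iterates have orthonormal columns, this inner product equals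
  \<open>1/2 tr (D P\<^sub>k D\<^sup>H)\<close> (\<open>polar_factor_inner_gap\<close>). The least eigenvalue of \<open>P\<^sub>k\<close> is a singular value of
  \<open>G\<^sub>k\<close>, hence larger than \<open>\<delta>\<close>, so every step increases \<open>g\<close> by at least \<open>\<delta>/2\<close> times the squared
  norm of \<open>D\<close> (\<open>polar_factor_sufficient_increase\<close>). The Stiefel manifold is compact, so \<open>g\<close> is
  bounded on it and the monotone sequence of the values of \<open>g\<close> at the iterates converges; therefore
  \<open>D\<close> tends to zero (\<open>PDOI_steps_tendsto_zero\<close>).

  If a subsequence of the \<open>U\<^sub>k\<close> converges to \<open>V\<close>, the shifted subsequence of the \<open>U\<^sub>k\<^sub>+\<^sub>1\<close> has the same
  limit. Eliminating \<open>P\<^sub>k\<close> as \<open>U\<^sub>k\<^sub>+\<^sub>1\<^sup>H G\<^sub>k\<close> turns the polar factorization into equations that are closed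
  under limits. In the limit they give, for the gradient \<open>G\<close> at \<open>V\<close>, that \<open>V\<^sup>H G\<close> is Hermitian and
  \<open>G = V V\<^sup>H G\<close>, which says that the Riemannian gradient at \<open>V\<close> vanishes.\<close>

section \<open>Conjugate transposes and the real inner product\<close>

lemma conj_transpose_conj_transpose [simp]: "conj_transpose (conj_transpose X) = X"
  by (simp add: conj_transpose_def vec_eq_iff)

lemma conj_transpose_mult: "conj_transpose (X ** Y) = conj_transpose Y ** conj_transpose X"
  by (simp add: conj_transpose_def matrix_matrix_mult_def vec_eq_iff mult.commute)

lemma matrix_diff_rdistrib: "(A - B) ** C = A ** C - B ** (C :: complex^'r^'k)"
  by (simp add: matrix_matrix_mult_def vec_eq_iff sum_subtractf algebra_simps)

lemma inner_matrix_mult_left_factor: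
  fixes X :: "complex^'r^'n" and Y :: "complex^'k^'n" and Z :: "complex^'r^'k"
  shows "X \<bullet> (Y ** Z) = (conj_transpose Y ** X) \<bullet> Z"
  by (simp add: inner_matrix_eq_Re_trace conj_transpose_mult matrix_mul_assoc)

lemma inner_matrix_mult_right_factor:
  fixes X :: "complex^'r^'n" and Y :: "complex^'k^'n" and Z :: "complex^'r^'k"
  shows "X \<bullet> (Y ** Z) = (X ** conj_transpose Z) \<bullet> Y"
  by (metis (no_types) inner_matrix_eq_Re_trace conj_transpose_mult conj_transpose_conj_transpose
      matrix_mul_assoc trace_mul_sym)

lemma inner_matrix_vector_mult:
  fixes v :: "complex^'n" and w :: "complex^'r"
  shows "v \<bullet> (P *v w) = (conj_transpose P *v v) \<bullet> w"
proof -
  have "v \<bullet> (P *v w) = (\<Sum>i\<in>UNIV. \<Sum>j\<in>UNIV. Re (cnj (v $ i) * P $ i $ j * w $ j))"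
    by (simp add: inner_vec_def inner_complex_def matrix_vector_mult_def sum_distrib_left
        mult.assoc flip: Re_sum)
       (simp add: algebra_simps sum.distrib sum_subtractf sum_distrib_left)
  also have "\<dots> = (\<Sum>j\<in>UNIV. \<Sum>i\<in>UNIV. Re (cnj (v $ i) * P $ i $ j * w $ j))"
    by (rule sum.swap)
  also have "\<dots> = (conj_transpose P *v v) \<bullet> w"
    by (simp add: inner_vec_def inner_complex_def matrix_vector_mult_def conj_transpose_def
        sum_distrib_left sum_distrib_right algebra_simps sum.distrib sum_subtractf)
  finally show ?thesis .
qed

text \<open>The left-hand side is \<open>Re (tr (D P D\<^sup>H))\<close>, which splits into the quadratic form of \<open>P\<close> at the conjugated rows of
  \<open>D\<close>. This is how a bound on the quadratic form of \<open>P\<close> becomes a bound for rectangular matrices.\<close>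

lemma inner_mult_right_eq_sum_rows:
  fixes D :: "complex^'r^'n"
  defines "w \<equiv> \<lambda>i. \<chi> j. cnj (D $ i $ j)"
  shows "D \<bullet> (D ** P) = (\<Sum>i\<in>UNIV. w i \<bullet> (P *v w i))"
proof -
  have "(D $ i) \<bullet> ((D ** P) $ i) = w i \<bullet> (P *v w i)" for i
  proof -
    have "(D $ i) \<bullet> ((D ** P) $ i)
        = (\<Sum>j\<in>UNIV. \<Sum>k\<in>UNIV. Re (cnj (D $ i $ j) * (D $ i $ k * P $ k $ j)))"
      by (simp only: inner_vec_def inner_complex_def matrix_matrix_mult_def vec_lambda_beta
          flip: Re_sum sum_distrib_left) simp
    also have "\<dots> = (\<Sum>k\<in>UNIV. \<Sum>j\<in>UNIV. Re (cnj (D $ i $ j) * (D $ i $ k * P $ k $ j)))"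
      by (rule sum.swap)
    also have "\<dots> = (\<Sum>k\<in>UNIV. \<Sum>j\<in>UNIV. Re (cnj (w i $ k) * (P $ k $ j * w i $ j)))"
      by (simp only: w_def vec_lambda_beta complex_cnj_cnj mult_ac)
    also have "\<dots> = w i \<bullet> (P *v w i)"
      by (simp only: inner_vec_def inner_complex_def matrix_vector_mult_def vec_lambda_beta
          flip: Re_sum sum_distrib_left) simp
    finally show ?thesis .
  qed
  then show ?thesis
    by (simp add: inner_vec_def[of D])
qed

section \<open>Extremal eigenvalues of self-adjoint maps\<close>

text \<open>A zero of a positive semidefinite form is a minimum of the form, so its derivative \<open>2 q v\<close>
  vanishes there. The proof shifts \<open>v\<close> along \<open>q v\<close> to a point at which the form would be negative
  unless \<open>q v = 0\<close>.\<close>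

lemma psd_form_zero_imp_kernel:
  fixes q :: "'a::real_inner \<Rightarrow> 'a"
  assumes lin: "linear q" and sym: "\<And>v w. v \<bullet> q w = q v \<bullet> w"
    and psd: "\<And>v. 0 \<le> v \<bullet> q v" and zero: "v \<bullet> q v = 0"
  shows "q v = 0"
proof -
  have expand: "(v + t *\<^sub>R w) \<bullet> q (v + t *\<^sub>R w) = 2 * t * (q v \<bullet> w) + t\<^sup>2 * (w \<bullet> q w)" for t w
    using sym[of v w] zero
    by (simp add: linear_add[OF lin] linear_scale[OF lin] inner_add_left inner_add_right
        power2_eq_square algebra_simps inner_commute)
  define c where "c = q v \<bullet> q (q v)"
  have c: "0 \<le> c" using psd by (simp add: c_def)
  define a where "a = q v \<bullet> q v"
  \<comment> \<open>With \<open>t = - \<epsilon> a\<close> the value is \<open>- \<epsilon> a\<^sup>2 (2 - \<epsilon> c)\<close>, so \<open>\<epsilon> < 2 / c\<close> is needed;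
    \<open>1 / (c + 1)\<close> also covers \<open>c = 0\<close>.\<close>
  define t where "t = - a / (c + 1)"
  have "0 \<le> 2 * t * a + t\<^sup>2 * c"
    using psd[of "v + t *\<^sub>R q v"] expand[of t "q v"] by (simp add: c_def a_def)
  also have "\<dots> = - (a\<^sup>2 * (c + 2) / (c + 1)\<^sup>2)"
    using c by (simp add: t_def divide_simps) (simp add: power2_eq_square algebra_simps)
  finally have "a\<^sup>2 * (c + 2) / (c + 1)\<^sup>2 \<le> 0"
    by simp
  moreover have "0 < (c + 2) / (c + 1)\<^sup>2"
    using c by simp
  ultimately have "a\<^sup>2 \<le> 0"
    by (metis mult_le_0_iff not_le times_divide_eq_right)
  then show ?thesis
    by (simp add: a_def)
qed

text \<open>The minimum \<open>l\<close> of the quadratic form over the unit sphere is attained, by compactness. The form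
  of \<open>p - l\<close> is then positive semidefinite and vanishes at the minimizer, which is therefore an
  eigenvector.\<close>

lemma self_adjoint_least_eigenvalue:
  fixes p :: "'a::euclidean_space \<Rightarrow> 'a"
  assumes lin: "linear p" and sym: "\<And>v w. v \<bullet> p w = p v \<bullet> w"
  shows "\<exists>v l. v \<noteq> 0 \<and> p v = l *\<^sub>R v \<and> (\<forall>w. l * (w \<bullet> w) \<le> w \<bullet> p w)"
proof -
  have "continuous_on (sphere 0 1) (\<lambda>v. v \<bullet> p v)"
    using lin by (intro continuous_intros linear_continuous_on)
      (simp add: linear_conv_bounded_linear)
  moreover have "sphere (0::'a) 1 \<noteq> {}"
    by simp
  ultimately obtain v where v: "norm v = 1" "\<And>w. norm w = 1 \<Longrightarrow> v \<bullet> p v \<le> w \<bullet> p w"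
    using continuous_attains_inf[of "sphere (0::'a) 1" "\<lambda>v. v \<bullet> p v"] by auto
  define l where "l = v \<bullet> p v"
  have bound: "l * (w \<bullet> w) \<le> w \<bullet> p w" for w
  proof (cases "w = 0")
    case False
    define u where "u = (1 / norm w) *\<^sub>R w"
    have w: "w = norm w *\<^sub>R u" and "norm u = 1"
      using False by (simp_all add: u_def)
    then have "l \<le> u \<bullet> p u"
      using v by (simp add: l_def)
    then have "(norm w)\<^sup>2 * l \<le> (norm w)\<^sup>2 * (u \<bullet> p u)"
      by (intro mult_left_mono) simp_all
    also have "\<dots> = (norm w *\<^sub>R u) \<bullet> p (norm w *\<^sub>R u)"
      by (simp add: linear_scale[OF lin] power2_eq_square)
    also have "\<dots> = w \<bullet> p w"
      by (simp only: w[symmetric])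
    finally show ?thesis
      by (simp add: power2_norm_eq_inner mult.commute)
  qed (simp add: linear_0[OF lin])
  define q where "q = (\<lambda>w. p w - l *\<^sub>R w)"
  have "linear q"
    unfolding q_def by (intro linear_compose_sub lin linear_scale_self)
  moreover have "x \<bullet> q y = q x \<bullet> y" for x y
    using sym[of x y] by (simp add: q_def inner_diff_left inner_diff_right)
  moreover have "0 \<le> x \<bullet> q x" for x
    using bound[of x] by (simp add: q_def inner_diff_right)
  moreover have "v \<bullet> q v = 0"
    using v(1) by (simp add: q_def inner_diff_right l_def norm_eq_1)
  ultimately have "q v = 0"
    by (rule psd_form_zero_imp_kernel)
  then have "p v = l *\<^sub>R v"
    by (simp add: q_def)
  moreover have "v \<noteq> 0"
    using v(1) by auto
  ultimately show ?thesis
    using bound by blast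
qed

text \<open>Eigenvectors for distinct eigenvalues are orthogonal, hence linearly independent.\<close>

lemma self_adjoint_finite_eigenvalues:
  fixes p :: "'a::euclidean_space \<Rightarrow> 'a"
  assumes sym: "\<And>v w. v \<bullet> p w = p v \<bullet> w"
  shows "finite {l. \<exists>v. v \<noteq> 0 \<and> p v = l *\<^sub>R v}" (is "finite ?E")
proof -
  have "\<forall>l\<in>?E. \<exists>v. v \<noteq> 0 \<and> p v = l *\<^sub>R v"
    by simp
  from bchoice[OF this] obtain e where e: "\<And>l. l \<in> ?E \<Longrightarrow> e l \<noteq> 0 \<and> p (e l) = l *\<^sub>R e l"
    by blast
  have orth: "e l \<bullet> e m = 0" if "l \<in> ?E" "m \<in> ?E" "l \<noteq> m" for l m
    using sym[of "e l" "e m"] e[OF that(1)] e[OF that(2)] that(3) by simp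
  have inj: "inj_on e ?E"
  proof (rule inj_onI, rule ccontr)
    fix l m assume "l \<in> ?E" "m \<in> ?E" "e l = e m" "l \<noteq> m"
    then show False
      using orth[of l m] e[of m] by simp
  qed
  have "independent (e ` ?E)"
  proof (rule pairwise_orthogonal_independent)
    show "pairwise orthogonal (e ` ?E)"
      unfolding pairwise_def orthogonal_def using orth by blast
    show "0 \<notin> e ` ?E"
      using e by force
  qed
  then show ?thesis
    using inj independent_imp_finite finite_imageD by blast
qed

section \<open>The polar factor and the least singular value\<close>

lemma matrix_vector_self_adjoint:
  fixes P :: "complex^'r^'r"
  assumes "conj_transpose P = P"
  shows "v \<bullet> (P *v w) = (P *v v) \<bullet> w"
  using inner_matrix_vector_mult[of v P w] assms by simp

lemma complex_of_real_scalar_mult_eq_scaleR: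
  "complex_of_real c *s (v :: complex^'r) = c *\<^sub>R v"
  unfolding vec_eq_iff vector_scalar_mult_def vector_scaleR_component
  by (simp add: scaleR_conv_of_real)

text \<open>Since \<open>sigma_min\<close> is a \<open>Min\<close>, it bounds the singular values from below only because they form a
  finite set.\<close>

lemma finite_singular_values:
  fixes X :: "complex^'r^'n"
  shows "finite (singular_values X)"
proof -
  define M where "M = conj_transpose X ** X"
  have "conj_transpose M = M"
    by (simp add: M_def conj_transpose_mult)
  then have "finite {l. \<exists>v. v \<noteq> 0 \<and> M *v v = l *\<^sub>R v}"
    by (intro self_adjoint_finite_eigenvalues matrix_vector_self_adjoint)
  then have "finite (sqrt ` {l. \<exists>v. v \<noteq> 0 \<and> M *v v = l *\<^sub>R v})"
    by simp
  moreover have "singular_values X \<subseteq> sqrt ` {l. \<exists>v. v \<noteq> 0 \<and> M *v v = l *\<^sub>R v}"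
  proof
    fix s assume "s \<in> singular_values X"
    then have "s = sqrt (s\<^sup>2)" "s\<^sup>2 \<in> {l. \<exists>v. v \<noteq> 0 \<and> M *v v = l *\<^sub>R v}"
      unfolding singular_values_def M_def complex_of_real_scalar_mult_eq_scaleR by auto
    then show "s \<in> sqrt ` {l. \<exists>v. v \<noteq> 0 \<and> M *v v = l *\<^sub>R v}"
      by (rule image_eqI)
  qed
  ultimately show ?thesis
    by (rule finite_subset[rotated])
qed

text \<open>An eigenvalue \<open>l\<close> of \<open>P\<close> gives the eigenvalue \<open>l\<^sup>2\<close> of \<open>(W P)\<^sup>H W P = P\<^sup>2\<close>, so \<open>l\<close>, being
  nonnegative, is a singular value of \<open>W P\<close>. Applied to the least eigenvalue of \<open>P\<close>, this bounds the
  quadratic form.\<close>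

lemma sigma_min_le_quadratic_form:
  fixes P :: "complex^'r^'r" and W :: "complex^'r^'n"
  assumes W: "W \<in> Stiefel" and P: "hermitian_psd P"
  shows "sigma_min (W ** P) * (w \<bullet> w) \<le> w \<bullet> (P *v w)"
proof -
  have herm: "conj_transpose P = P" and psd: "\<And>v. 0 \<le> v \<bullet> (P *v v)"
    using P by (auto simp: hermitian_psd_def)
  obtain v l where v: "v \<noteq> 0" "P *v v = l *\<^sub>R v"
    and l: "\<And>w. l * (w \<bullet> w) \<le> w \<bullet> (P *v w)"
    using self_adjoint_least_eigenvalue[OF matrix_vector_mul_linear[of P]
        matrix_vector_self_adjoint[OF herm]] by auto
  have "0 \<le> l * (v \<bullet> v)"
    using psd[of v] v by simp
  then have "0 \<le> l"
    using v(1) inner_gt_zero_iff[of v] zero_le_mult_iff[of l "v \<bullet> v"] by linarith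
  have "conj_transpose (W ** P) ** (W ** P) = P ** (conj_transpose W ** W) ** P"
    by (simp add: conj_transpose_mult herm matrix_mul_assoc)
  also have "\<dots> = P ** P"
    using W by (simp add: Stiefel_def)
  finally have "(conj_transpose (W ** P) ** (W ** P)) *v v = P *v (P *v v)"
    by (simp add: matrix_vector_mul_assoc)
  also have "\<dots> = complex_of_real (l\<^sup>2) *s v"
    unfolding complex_of_real_scalar_mult_eq_scaleR
    by (simp add: v(2) linear_scale[OF matrix_vector_mul_linear] power2_eq_square)
  finally have "l \<in> singular_values (W ** P)"
    using v(1) \<open>0 \<le> l\<close> by (auto simp: singular_values_def)
  then have "sigma_min (W ** P) \<le> l"
    unfolding sigma_min_def by (intro Min_le finite_singular_values)
  then show ?thesis
    using l[of w] by (meson inner_ge_zero mult_right_mono order_trans)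
qed

text \<open>Expand the left-hand side: \<open>A\<close> and \<open>B\<close> have orthonormal columns, so both diagonal terms equal
  the trace of \<open>P\<close>, and \<open>P\<close> being Hermitian makes the two mixed terms equal.\<close>

lemma polar_factor_inner_gap:
  fixes A B :: "complex^'r^'n"
  assumes A: "A \<in> Stiefel" and B: "B \<in> Stiefel" and herm: "conj_transpose P = P"
  shows "(A - B) \<bullet> ((A - B) ** P) = 2 * ((A - B) \<bullet> (A ** P))"
proof -
  have "B \<bullet> (B ** P) = A \<bullet> (A ** P)"
    using A B by (simp add: inner_matrix_mult_left_factor Stiefel_def)
  moreover have "A \<bullet> (B ** P) = B \<bullet> (A ** P)"
    using inner_matrix_mult_right_factor[of A B P] herm by (simp add: inner_commute)
  ultimately show ?thesis
    by (simp add: matrix_diff_rdistrib inner_diff_left inner_diff_right)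
qed

text \<open>The polar factor \<open>A\<close> maximizes the linear functional \<open>X \<mapsto> X \<bullet> G\<close> over the Stiefel manifold;
  this quantifies by how much it beats a competitor \<open>B\<close>.\<close>

lemma polar_factor_sufficient_increase:
  fixes G A B :: "complex^'r^'n"
  assumes polar: "orthogonal_polar_factor G A" and B: "B \<in> Stiefel"
  shows "sigma_min G / 2 * (norm (A - B))\<^sup>2 \<le> (A - B) \<bullet> G"
proof -
  obtain P where A: "A \<in> Stiefel" and P: "hermitian_psd P" and G: "G = A ** P"
    using polar by (auto simp: orthogonal_polar_factor_def)
  define D where "D = A - B"
  define w :: "'n \<Rightarrow> complex^'r" where "w = (\<lambda>i. \<chi> j. cnj (D $ i $ j))"
  have "(norm D)\<^sup>2 = (\<Sum>i\<in>UNIV. w i \<bullet> w i)"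
    by (simp add: power2_norm_eq_inner inner_vec_def w_def inner_complex_def)
  then have "sigma_min G * (norm D)\<^sup>2 = (\<Sum>i\<in>UNIV. sigma_min G * (w i \<bullet> w i))"
    by (simp add: sum_distrib_left)
  also have "\<dots> \<le> (\<Sum>i\<in>UNIV. w i \<bullet> (P *v w i))"
    unfolding G by (intro sum_mono sigma_min_le_quadratic_form A P)
  also have "\<dots> = D \<bullet> (D ** P)"
    by (simp add: inner_mult_right_eq_sum_rows w_def)
  also have "\<dots> = 2 * (D \<bullet> G)"
    using polar_factor_inner_gap[OF A B] P by (simp add: D_def G hermitian_psd_def)
  finally show ?thesis
    by (simp add: D_def)
qed

section \<open>Gradients of smooth convex functions\<close>

lemma eucl_grad_eqI:
  assumes "GDERIV g x :> D"
  shows "eucl_grad g x = D"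
proof -
  have "E = D" if "GDERIV g x :> E" for E
  proof -
    have "(\<lambda>h. h \<bullet> E) = (\<lambda>h. h \<bullet> D)"
      using has_derivative_unique[OF that[unfolded gderiv_def] assms[unfolded gderiv_def]] .
    then have "h \<bullet> E = h \<bullet> D" for h
      by (rule fun_cong)
    then show ?thesis
      using vector_eq_ldot by blast
  qed
  then show ?thesis
    unfolding eucl_grad_def using assms by (rule the_equality[rotated])
qed

lemma GDERIV_frechet_derivative:
  fixes g :: "'a::euclidean_space \<Rightarrow> real"
  assumes "g differentiable (at x)"
  shows "GDERIV g x :> (\<Sum>b\<in>Basis. frechet_derivative g (at x) b *\<^sub>R b)"
proof -
  have deriv: "(g has_derivative frechet_derivative g (at x)) (at x)"
    using assms by (simp add: frechet_derivative_works)
  then have lin: "linear (frechet_derivative g (at x))"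
    by (rule has_derivative_linear)
  have "frechet_derivative g (at x) h
      = h \<bullet> (\<Sum>b\<in>Basis. frechet_derivative g (at x) b *\<^sub>R b)" for h
    by (subst euclidean_representation[of h, symmetric])
       (simp only: linear_sum[OF lin] linear_scale[OF lin] inner_sum_right inner_scaleR_right
         real_scaleR_def mult.commute)
  then have "frechet_derivative g (at x)
      = (\<lambda>h. h \<bullet> (\<Sum>b\<in>Basis. frechet_derivative g (at x) b *\<^sub>R b))"
    by blast
  then show ?thesis
    unfolding gderiv_def using deriv by simp
qed

lemma smooth_on_UNIV_differentiable:
  assumes "smooth_on UNIV g"
  shows "g differentiable (at x)"
proof -
  obtain W h where W: "open W" "x \<in> W" "\<And>k. C_k_on k W h" "\<And>y. y \<in> W \<Longrightarrow> h y = g y"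
    using assms[unfolded smooth_on_def, THEN bspec, OF UNIV_I, of x] by auto
  have "h differentiable (at x)"
    using W(2) W(3)[of 1] by simp
  then obtain h' where "(h has_derivative h') (at x)"
    unfolding differentiable_def by blast
  then have "(g has_derivative h') (at x)"
    by (rule has_derivative_transform_within_open[OF _ W(1,2,4)])
  then show ?thesis
    by (rule differentiableI)
qed

text \<open>The coordinates of the gradient are directional derivatives along the basis vectors, and the
  case \<open>k = 1\<close> of \<open>C_k_on\<close> makes these continuous.\<close>

lemma smooth_on_UNIV_isCont_eucl_grad:
  fixes g :: "'a::euclidean_space \<Rightarrow> real"
  assumes "smooth_on UNIV g"
  shows "isCont (eucl_grad g) x"
proof -
  obtain W h where W: "open W" "x \<in> W" "\<And>k. C_k_on k W h" "\<And>y. y \<in> W \<Longrightarrow> h y = g y"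
    using assms[unfolded smooth_on_def, THEN bspec, OF UNIV_I, of x] by auto
  have diff: "h differentiable (at y)" if "y \<in> W" for y
    using W(3)[of 1] that by simp
  have "continuous_on W (\<lambda>y. frechet_derivative h (at y) v)" for v
    using W(3)[of 1] by simp
  then have "continuous_on W (\<lambda>y. \<Sum>b\<in>Basis. frechet_derivative h (at y) b *\<^sub>R b)"
    by (intro continuous_intros)
  moreover have "eucl_grad g y = (\<Sum>b\<in>Basis. frechet_derivative h (at y) b *\<^sub>R b)" if "y \<in> W" for y
  proof -
    have "frechet_derivative h (at y) = frechet_derivative g (at y)"
      using frechet_derivative_transform_within_open[OF diff[OF that] W(1) that W(4)] .
    with eucl_grad_eqI[OF GDERIV_frechet_derivative[OF smooth_on_UNIV_differentiable[OF assms], of y]]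
    show ?thesis
      by simp
  qed
  ultimately have "continuous_on W (eucl_grad g)"
    by (simp cong: continuous_on_cong)
  then show ?thesis
    using W(1,2) continuous_on_eq_continuous_at by blast
qed

text \<open>Restricting \<open>g\<close> to the line through \<open>x\<close> and \<open>y\<close> reduces this to the tangent line inequality
  for convex functions of one real variable.\<close>

lemma convex_on_above_tangent_plane:
  fixes g :: "'a::real_inner \<Rightarrow> real"
  assumes conv: "convex_on UNIV g" and grad: "GDERIV g x :> D"
  shows "(y - x) \<bullet> D \<le> g y - g x"
proof -
  define \<phi> where "\<phi> = (\<lambda>t. g (x + t *\<^sub>R (y - x)))"
  have "convex_on UNIV \<phi>"
  proof (rule convex_onI)
    fix t a b :: real assume t: "0 < t" "t < 1"
    have "x + ((1 - t) *\<^sub>R a + t *\<^sub>R b) *\<^sub>R (y - x)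
        = (1 - t) *\<^sub>R (x + a *\<^sub>R (y - x)) + t *\<^sub>R (x + b *\<^sub>R (y - x))"
      by (simp add: algebra_simps)
    then show "\<phi> ((1 - t) *\<^sub>R a + t *\<^sub>R b) \<le> (1 - t) * \<phi> a + t * \<phi> b"
      using convex_onD[OF conv, of t] t unfolding \<phi>_def by simp
  qed simp
  moreover have "(\<phi> has_real_derivative (y - x) \<bullet> D) (at 0)"
  proof -
    have line: "((\<lambda>t::real. x + t *\<^sub>R (y - x)) has_derivative (\<lambda>t. t *\<^sub>R (y - x))) (at 0)"
      by (auto intro!: derivative_eq_intros)
    have "(g has_derivative (\<lambda>h. h \<bullet> D)) (at (x + 0 *\<^sub>R (y - x)))"
      using grad by (simp add: gderiv_def)
    from has_derivative_compose[OF line this] show ?thesis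
      by (simp add: \<phi>_def has_field_derivative_def mult.commute[of _ "(y - x) \<bullet> D"])
  qed
  ultimately have "((y - x) \<bullet> D) * (1 - 0) \<le> \<phi> 1 - \<phi> 0"
    by (intro convex_on_imp_above_tangent[of UNIV]) auto
  then show ?thesis
    by (simp add: \<phi>_def)
qed

section \<open>Limits along the Stiefel manifold\<close>

lemma tendsto_matrix_mult [tendsto_intros]:
  fixes X :: "'a \<Rightarrow> complex^'k^'n" and Y :: "'a \<Rightarrow> complex^'r^'k"
  assumes "(X \<longlongrightarrow> A) F" "(Y \<longlongrightarrow> B) F"
  shows "((\<lambda>t. X t ** Y t) \<longlongrightarrow> A ** B) F"
  unfolding matrix_matrix_mult_def by (intro tendsto_intros assms)

lemma tendsto_conj_transpose [tendsto_intros]: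
  assumes "(X \<longlongrightarrow> A) F"
  shows "((\<lambda>t. conj_transpose (X t)) \<longlongrightarrow> conj_transpose A) F"
  unfolding conj_transpose_def by (intro tendsto_intros assms)

lemma closed_Stiefel: "closed Stiefel"
  unfolding closed_sequential_limits
proof clarify
  fix X :: "nat \<Rightarrow> complex^'r^'n" and V
  assume X: "\<forall>n. X n \<in> Stiefel" and lim: "X \<longlonglongrightarrow> V"
  have "(\<lambda>n. conj_transpose (X n) ** X n) \<longlonglongrightarrow> conj_transpose V ** V"
    by (intro tendsto_intros lim)
  moreover have "(\<lambda>n. conj_transpose (X n) ** X n) = (\<lambda>_. mat 1)"
    using X by (simp add: Stiefel_def)
  ultimately show "V \<in> Stiefel"
    by (simp add: Stiefel_def LIMSEQ_const_iff)
qed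

text \<open>Boundedness: orthonormal columns fix the norm of the matrix to that of the identity.\<close>

lemma compact_Stiefel: "compact (Stiefel :: (complex^'r^'n) set)"
proof -
  have "norm X = norm (mat 1 :: complex^'r^'r)" if "X \<in> Stiefel" for X :: "complex^'r^'n"
    using inner_matrix_mult_left_factor[of X X "mat 1"] that
    by (simp add: norm_eq_sqrt_inner Stiefel_def)
  then have "bounded (Stiefel :: (complex^'r^'n) set)"
    by (intro boundedI[of _ "norm (mat 1 :: complex^'r^'r)"]) simp
  then show ?thesis
    by (simp add: compact_eq_bounded_closed closed_Stiefel)
qed

lemma stationary_point_if_hermitian_factor:
  assumes V: "V \<in> Stiefel"
    and G: "eucl_grad g V = V ** (conj_transpose V ** eucl_grad g V)"
    and herm: "conj_transpose (conj_transpose V ** eucl_grad g V) = conj_transpose V ** eucl_grad g V"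
  shows "stationary_point g V"
proof -
  have "hermitian_part (conj_transpose V ** eucl_grad g V) = conj_transpose V ** eucl_grad g V"
    by (simp add: hermitian_part_def herm flip: scaleR_2)
  then show ?thesis
    using V G by (simp add: stationary_point_def riem_grad_def)
qed

section \<open>Convergence of the polar iteration\<close>

lemma PDOI_iterates_in_Stiefel:
  assumes "PDOI_iterates g U"
  shows "U k \<in> Stiefel"
  using assms by (cases k) (auto simp: PDOI_iterates_def orthogonal_polar_factor_def dest: spec[of _ k])

text \<open>The Hermitian factor is recovered as \<open>A\<^sup>H G\<close>. The resulting two identities mention only \<open>G\<close>
  and \<open>A\<close>, so they pass to limits without a convergence argument for the Hermitian factors.\<close>

lemma orthogonal_polar_factor_identities:
  assumes "orthogonal_polar_factor G A"
  shows "G = A ** (conj_transpose A ** G)"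
    and "conj_transpose (conj_transpose A ** G) = conj_transpose A ** G"
proof -
  obtain P where A: "conj_transpose A ** A = mat 1" and P: "conj_transpose P = P" and G: "G = A ** P"
    using assms by (auto simp: orthogonal_polar_factor_def Stiefel_def hermitian_psd_def)
  have "conj_transpose A ** G = P"
    by (simp add: G A matrix_mul_assoc)
  then show "G = A ** (conj_transpose A ** G)"
    and "conj_transpose (conj_transpose A ** G) = conj_transpose A ** G"
    using G P by simp_all
qed

text \<open>The squared step lengths are bounded by a multiple of the increments of \<open>g\<close>, and these tend to
  zero because \<open>g\<close> increases along the iterates and is bounded on the compact Stiefel manifold.\<close>

lemma PDOI_steps_tendsto_zero:
  fixes g :: "complex^'r^'n \<Rightarrow> real"
  assumes smooth: "smooth_on UNIV g" and conv: "convex_on UNIV g" and iter: "PDOI_iterates g U"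
    and \<delta>: "0 < \<delta>" "\<And>k. \<delta> \<le> sigma_min (eucl_grad g (U k))"
  shows "(\<lambda>k. U (Suc k) - U k) \<longlonglongrightarrow> 0"
proof -
  have increase: "\<delta> / 2 * (norm (U (Suc k) - U k))\<^sup>2 \<le> g (U (Suc k)) - g (U k)" for k
  proof -
    have "orthogonal_polar_factor (eucl_grad g (U k)) (U (Suc k))"
      using iter by (auto simp: PDOI_iterates_def dest: spec[of _ "Suc k"])
    then have "sigma_min (eucl_grad g (U k)) / 2 * (norm (U (Suc k) - U k))\<^sup>2
        \<le> (U (Suc k) - U k) \<bullet> eucl_grad g (U k)"
      by (intro polar_factor_sufficient_increase PDOI_iterates_in_Stiefel[OF iter])
    moreover have "GDERIV g (U k) :> eucl_grad g (U k)"
      using GDERIV_frechet_derivative[OF smooth_on_UNIV_differentiable[OF smooth], of "U k"]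
      by (simp add: eucl_grad_eqI)
    moreover have "\<delta> / 2 * (norm (U (Suc k) - U k))\<^sup>2
        \<le> sigma_min (eucl_grad g (U k)) / 2 * (norm (U (Suc k) - U k))\<^sup>2"
      using \<delta>(2) by (intro mult_right_mono) simp_all
    ultimately show ?thesis
      using convex_on_above_tangent_plane[OF conv] by (meson order_trans)
  qed
  have "continuous_on Stiefel g"
    by (intro continuous_at_imp_continuous_on ballI differentiable_imp_continuous_within
        smooth_on_UNIV_differentiable[OF smooth])
  then have "bounded (g ` Stiefel)"
    by (intro compact_imp_bounded compact_continuous_image compact_Stiefel)
  then obtain b where "\<And>X. X \<in> Stiefel \<Longrightarrow> norm (g X) \<le> b"
    by (auto simp: bounded_iff)
  then have bound: "g (U k) \<le> b" for k
    using PDOI_iterates_in_Stiefel[OF iter, of k] by fastforce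
  have "g (U k) \<le> g (U (Suc k))" for k
  proof -
    have "0 \<le> \<delta> / 2 * (norm (U (Suc k) - U k))\<^sup>2"
      using \<delta>(1) by simp
    then show ?thesis
      using increase[of k] by linarith
  qed
  then have "incseq (\<lambda>k. g (U k))"
    by (rule incseq_SucI)
  with bound obtain L where L: "(\<lambda>k. g (U k)) \<longlonglongrightarrow> L"
    using incseq_convergent by blast
  have "(\<lambda>k. 2 / \<delta> * (g (U (Suc k)) - g (U k))) \<longlonglongrightarrow> 2 / \<delta> * (L - L)"
    by (intro tendsto_intros L LIMSEQ_Suc)
  then have "(\<lambda>k. 2 / \<delta> * (g (U (Suc k)) - g (U k))) \<longlonglongrightarrow> 0"
    by simp
  moreover have "\<forall>\<^sub>F k in sequentially.
      norm ((norm (U (Suc k) - U k))\<^sup>2) \<le> 2 / \<delta> * (g (U (Suc k)) - g (U k))"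
    using increase \<delta>(1) by (simp add: field_simps)
  ultimately have "(\<lambda>k. (norm (U (Suc k) - U k))\<^sup>2) \<longlonglongrightarrow> 0"
    by (rule Lim_null_comparison[rotated])
  from tendsto_real_sqrt[OF this] show ?thesis
    by (simp add: tendsto_norm_zero_iff)
qed

theorem theorem4p4:
  fixes f :: "(complex^'r::finite^'n::finite)^'d::finite \<Rightarrow> real"
    and g :: "complex^'r^'n \<Rightarrow> real"
    and U :: "nat \<Rightarrow> complex^'r^'n"
    and \<delta> :: real
  assumes "CARD('r) \<le> CARD('n)"
    and "CARD('d) > 1"
    and "smooth_on Omega_s f"
    and "symmetric_on_Omega_s f"
    and "\<And>X. X \<in> Omega_s \<Longrightarrow> f X \<ge> 0"
    and "\<And>X. X \<in> Stiefel \<Longrightarrow> g X = f (\<chi> i. X)"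
    and "smooth_on UNIV g"
    and "convex_on UNIV g"
    and "PDOI_iterates g U"
    and "\<delta> > 0"
    and "\<And>k. k \<ge> 1 \<Longrightarrow> sigma_min (eucl_grad g (U (k - 1))) > \<delta>"
  shows "\<forall>V. accumulation_point U V \<longrightarrow> stationary_point g V"
proof (intro allI impI)
  fix V assume "accumulation_point U V"
  then obtain s where s: "strict_mono s" and lim: "(\<lambda>j. U (s j)) \<longlonglongrightarrow> V"
    by (auto simp: accumulation_point_def o_def)
  define G where "G = (\<lambda>j. eucl_grad g (U (s j)))"
  define A where "A = (\<lambda>j. U (Suc (s j)))"
  have "\<delta> \<le> sigma_min (eucl_grad g (U k))" for k
    using assms(11)[of "Suc k"] by simp
  then have "(\<lambda>k. U (Suc k) - U k) \<longlonglongrightarrow> 0"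
    using assms by (intro PDOI_steps_tendsto_zero) auto
  from LIMSEQ_subseq_LIMSEQ[OF this s] have "(\<lambda>j. A j - U (s j)) \<longlonglongrightarrow> 0"
    by (simp add: o_def A_def)
  from tendsto_add[OF this lim] have A: "A \<longlonglongrightarrow> V"
    by simp
  have G: "G \<longlonglongrightarrow> eucl_grad g V"
    unfolding G_def
    by (rule isCont_tendsto_compose[OF smooth_on_UNIV_isCont_eucl_grad[OF assms(7)] lim])
  have "orthogonal_polar_factor (G j) (A j)" for j
    using assms(9) by (auto simp: PDOI_iterates_def G_def A_def dest: spec[of _ "Suc (s j)"])
  note polar = orthogonal_polar_factor_identities[OF this]
  show "stationary_point g V"
  proof (rule stationary_point_if_hermitian_factor)
    show "V \<in> Stiefel"
      using closed_sequentially[OF closed_Stiefel _ lim] PDOI_iterates_in_Stiefel[OF assms(9)] by blast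
    have "(\<lambda>j. A j ** (conj_transpose (A j) ** G j)) \<longlonglongrightarrow> V ** (conj_transpose V ** eucl_grad g V)"
      by (intro tendsto_intros A G)
    then have "G \<longlonglongrightarrow> V ** (conj_transpose V ** eucl_grad g V)"
      using polar(1) by simp
    then show "eucl_grad g V = V ** (conj_transpose V ** eucl_grad g V)"
      using G LIMSEQ_unique by blast
    have PH: "(\<lambda>j. conj_transpose (A j) ** G j) \<longlonglongrightarrow> conj_transpose V ** eucl_grad g V"
      by (intro tendsto_intros A G)
    from tendsto_conj_transpose[OF this]
    have "(\<lambda>j. conj_transpose (A j) ** G j)
        \<longlonglongrightarrow> conj_transpose (conj_transpose V ** eucl_grad g V)"
      by (simp only: polar(2))
    then show "conj_transpose (conj_transpose V ** eucl_grad g V)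
        = conj_transpose V ** eucl_grad g V"
      using PH LIMSEQ_unique by blast
  qed
qed

end
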